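(* Let $\mathbb{X}$ be a normed space, let $x_0\in\mathbb{X}\setminus\{0\}$, let $x^*$ be the bounded linear functional induced by $x_0$ and let $\mathbb{X}_{x_0}^+$ be the extensible cone induced by $x_0$. If $f:[a,b]\to\mathbb{X}$ is an increasing function in $(\mathbb{X},\mathbb{X}_{x_0}^+)$, then $x^*\circ f:[a,b]\to\mathbb{R}$ is increasing and $f\sim_{x_0}g$, where $g(t)=(x^*\circ f)(t)\,\frac{x_0}{\|x_0\|^2}$ for $t\in[a,b]$.
   Context: Normed spaces are real, and $\mathbb{X}^*$ is the space of bounded linear functionals on $\mathbb{X}$. Induced functional and cone: for $x_0\in\mathbb{X}\setminus\{0\}$, the functional $y^*(\beta x_0)=\beta\|x_0\|^2$ on $\mathrm{span}\{x_0\}$ has norm $\|x_0\|$; let $x^*\in\mathbb{X}^*$ be a fixed norm-preserving Hahn–Banach extension (so $x^*(x_0)=\|x_0\|^2$ and $\|x^*\|=\|x_0\|$), called the bounded linear functional induced by $x_0$. The induced (extensible) cone is $\mathbb{X}_{x_0}^+=\{x\in\mathbb{X}:x^*(x)\ge\alpha\|x\|\}$ for a fixed $\alpha\in(0,\|x_0\|]$. For functions $f_1,f_2:[a,b]\to\mathbb{X}$, $f_1\sim_{x_0}f_2$ means $x^*(f_1(t))=x^*(f_2(t))$ for all $t\in[a,b]$. $[a,b]=\{t:a\le t\le b\}$ is an order interval in a real ordered vector space (for instance a closed interval of $\mathbb{R}$). A function $g:[a,b]\to\mathbb{X}$ is increasing in $(\mathbb{X},\mathbb{X}_{x_0}^+)$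 if $s\le t$ in $[a,b]$ implies $g(t)-g(s)\in\mathbb{X}_{x_0}^+$; a real-valued function $h$ on $[a,b]$ is increasing if $s\le t$ implies $h(s)\le h(t)$. *)

theory Defs
  imports "HOL-Analysis.Analysis"
begin

(* xs is a norm-preserving extension to the whole space of the functional
   \<beta> x0 |-> \<beta> (norm x0)^2 on span {x0}, whose norm is norm x0.  Such an extension need not
   be unique, so this is a predicate; statements quantify over every admissible choice of xs. *)
definition induced_functional ::
  "'a::real_normed_vector \<Rightarrow> ('a \<Rightarrow>\<^sub>L real) \<Rightarrow> bool" where
  "induced_functional x0 xs \<longleftrightarrow>
     (\<forall>\<beta>. blinfun_apply xs (\<beta> *\<^sub>R x0) = \<beta> * (norm x0)\<^sup>2) \<and> norm xs = norm x0"

(* Intended for 0 < \<alpha> \<le> norm x0, where xs is induced by x0. *)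
definition induced_cone ::
  "('a::real_normed_vector \<Rightarrow>\<^sub>L real) \<Rightarrow> real \<Rightarrow> 'a set" where
  "induced_cone xs \<alpha> = {x. blinfun_apply xs x \<ge> \<alpha> * norm x}"

definition cone_increasing_on ::
  "'b::order set \<Rightarrow> 'a::real_normed_vector set \<Rightarrow> ('b \<Rightarrow> 'a) \<Rightarrow> bool" where
  "cone_increasing_on S K f \<longleftrightarrow> (\<forall>s\<in>S. \<forall>t\<in>S. s \<le> t \<longrightarrow> f t - f s \<in> K)"

definition functional_equiv_on ::
  "'b set \<Rightarrow> ('a::real_normed_vector \<Rightarrow>\<^sub>L real) \<Rightarrow> ('b \<Rightarrow> 'a) \<Rightarrow> ('b \<Rightarrow> 'a) \<Rightarrow> bool" where
  "functional_equiv_on S xs f1 f2 \<longleftrightarrow>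
     (\<forall>t\<in>S. blinfun_apply xs (f1 t) = blinfun_apply xs (f2 t))"

end

theory Submission
  imports Defs
begin

text \<open>
  The functional is nonnegative on its induced cone, because it dominates a nonnegative multiple of
  the norm there; by linearity it therefore turns cone increments of a function into
  nonnegative real increments.  The equivalence holds because
  \<open>x0 /\<^sub>R (norm x0)\<^sup>2\<close> is normalised to have value 1 under the functional, so that the
  multiple of it with coefficient \<open>c\<close> has value \<open>c\<close>.
\<close>

lemma mono_on_functional_comp:
  fixes xs :: "'a::real_normed_vector \<Rightarrow>\<^sub>L real"
  assumes "0 \<le> \<alpha>" and "cone_increasing_on S (induced_cone xs \<alpha>) f"
  shows "mono_on S (blinfun_apply xs \<circ> f)"
proof (rule mono_onI)
  fix s t assume "s \<in> S" "t \<in> S" "s \<le> t"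
  with assms(2) have "\<alpha> * norm (f t - f s) \<le> blinfun_apply xs (f t - f s)"
    by (auto simp: cone_increasing_on_def induced_cone_def)
  moreover have "0 \<le> \<alpha> * norm (f t - f s)"
    using assms(1) by simp
  ultimately show "(blinfun_apply xs \<circ> f) s \<le> (blinfun_apply xs \<circ> f) t"
    by (simp add: blinfun.diff_right)
qed

lemma induced_functional_normalised:
  assumes "x0 \<noteq> 0" and "induced_functional x0 xs"
  shows "blinfun_apply xs (x0 /\<^sub>R (norm x0)\<^sup>2) = 1"
  using assms by (simp add: induced_functional_def)

theorem lemma4p7:
  fixes x0 :: "'a::real_normed_vector"
    and xs :: "'a \<Rightarrow>\<^sub>L real"
    and \<alpha> :: real
    and a b :: "'b::ordered_real_vector"
    and f :: "'b \<Rightarrow> 'a"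
  assumes "x0 \<noteq> 0"
    and "induced_functional x0 xs"
    and "0 < \<alpha>" and "\<alpha> \<le> norm x0"
    and "cone_increasing_on {a..b} (induced_cone xs \<alpha>) f"
  shows "mono_on {a..b} (blinfun_apply xs \<circ> f) \<and>
         functional_equiv_on {a..b} xs f
           (\<lambda>t. (blinfun_apply xs \<circ> f) t *\<^sub>R (x0 /\<^sub>R (norm x0)\<^sup>2))"
proof
  show "mono_on {a..b} (blinfun_apply xs \<circ> f)"
    using assms(3,5) by (intro mono_on_functional_comp) auto
  show "functional_equiv_on {a..b} xs f
          (\<lambda>t. (blinfun_apply xs \<circ> f) t *\<^sub>R (x0 /\<^sub>R (norm x0)\<^sup>2))"
    unfolding functional_equiv_on_def blinfun.scaleR_right[of xs "(blinfun_apply xs \<circ> f) _"]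
      induced_functional_normalised[OF assms(1,2)]
    by simp
qed

end
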